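(* Let $0<\alpha<1$, let $I=[a,b]$ with $a<b$, and let $g:I\to\mathbb R$ be nonconstant, left-continuous, and nondecreasing. The following statements are equivalent. (i) $\kappa_g>0$. (ii) For every metric space $(X,d)$ and every $g$-Hölder map $F:I\to\mathcal K(X)$ of exponent $\alpha$, there exists a selection $f:I\to X$ of $F$ that is $g$-Hölder of exponent $\alpha$. (iii) There exists $C=C(g,\alpha)<\infty$ such that, for every metric space $(X,d)$, every $g$-Hölder map $F:I\to\mathcal K(X)$ of exponent $\alpha$, every $\theta\in I$, and every $x_\theta\in F(\theta)$, there exists a selection $f:I\to X$ of $F$ satisfying $$f(\theta)=x_\theta,\qquad [f]_{\alpha,g}\le C[F]_{\alpha,g}.$$ If $\kappa_g>0$, one may take $C=8\kappa_g^{-\alpha}$ in (iii).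
   Context: For a metric space $(X,d)$, $\mathcal K(X)$ is the family of nonempty compact subsets of $X$, with Hausdorff distance $d_H(A,B)=\max\{\sup_{x\in A}d(x,B),\sup_{y\in B}d(y,A)\}$. A map $F:I\to\mathcal K(X)$ is $g$-Hölder of exponent $\alpha$ if there is $L\ge0$ with $d_H(F(s),F(t))\le L|g(t)-g(s)|^\alpha$ for all $s,t\in I$; the least such $L$ is $[F]_{\alpha,g}$. For a single-valued map $f:I\to X$, being $g$-Hölder of exponent $\alpha$ and $[f]_{\alpha,g}$ are defined analogously, with $d$ in place of $d_H$. A selection of $F$ is a map $f:I\to X$ with $f(t)\in F(t)$ for every $t\in I$. For $g$ left-continuous and nondecreasing on $I=[a,b]$ and $\tau\in[a,b)$, set $\Delta^+g(\tau)=g(\tau+)-g(\tau)$, where $g(\tau+)$ is the right limit. For $s<t$ in $I$ set $J_g(s,t)=\sup_{\tau\in[s,t)}\Delta^+g(\tau)$. For nonconstant $g$, $$\kappa_g=\inf_{\substack{a\le s<t\le b\\ g(s)<g(t)}}\frac{J_g(s,t)}{g(t)-g(s)}.$$ *)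

theory Defs
  imports "HOL-Analysis.Analysis"
begin

section \<open>Compact subsets and the Hausdorff distance\<close>

definition compact_subsets :: "'x set \<Rightarrow> ('x \<Rightarrow> 'x \<Rightarrow> real) \<Rightarrow> 'x set set" where
  "compact_subsets M d = {A. A \<noteq> {} \<and> compactin (Metric_space.mtopology M d) A}"

definition dist_to_set :: "('x \<Rightarrow> 'x \<Rightarrow> real) \<Rightarrow> 'x \<Rightarrow> 'x set \<Rightarrow> real" where
  "dist_to_set d x B = (INF y\<in>B. d x y)"

text \<open>The suprema and infima are taken in the conditionally complete lattice of the reals, so the
  value is meaningful for nonempty bounded sets, in particular for members of
  \<^const>\<open>compact_subsets\<close>.\<close>

definition hausdorff_dist :: "('x \<Rightarrow> 'x \<Rightarrow> real) \<Rightarrow> 'x set \<Rightarrow> 'x set \<Rightarrow> real" where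
  "hausdorff_dist d A B = max (SUP x\<in>A. dist_to_set d x B) (SUP y\<in>B. dist_to_set d y A)"


section \<open>Hoelder maps with respect to a function g\<close>

text \<open>Here \<open>D\<close> is the distance on the target: \<open>d\<close> itself for single-valued maps and
  \<open>hausdorff_dist d\<close> for set-valued ones.  Functions on \<open>[a,b]\<close> are total functions on the reals of
  which only the values on \<open>{a..b}\<close> are used.\<close>

definition g_holder_bound ::
    "('y \<Rightarrow> 'y \<Rightarrow> real) \<Rightarrow> real set \<Rightarrow> (real \<Rightarrow> real) \<Rightarrow> real \<Rightarrow> (real \<Rightarrow> 'y) \<Rightarrow> real \<Rightarrow> bool" where
  "g_holder_bound D I g \<alpha> F L \<longleftrightarrow>
     0 \<le> L \<and> (\<forall>s\<in>I. \<forall>t\<in>I. D (F s) (F t) \<le> L * \<bar>g t - g s\<bar> powr \<alpha>)"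

definition g_holder ::
    "('y \<Rightarrow> 'y \<Rightarrow> real) \<Rightarrow> real set \<Rightarrow> (real \<Rightarrow> real) \<Rightarrow> real \<Rightarrow> (real \<Rightarrow> 'y) \<Rightarrow> bool" where
  "g_holder D I g \<alpha> F \<longleftrightarrow> (\<exists>L. g_holder_bound D I g \<alpha> F L)"

definition g_holder_seminorm ::
    "('y \<Rightarrow> 'y \<Rightarrow> real) \<Rightarrow> real set \<Rightarrow> (real \<Rightarrow> real) \<Rightarrow> real \<Rightarrow> (real \<Rightarrow> 'y) \<Rightarrow> real" where
  "g_holder_seminorm D I g \<alpha> F = (LEAST L. g_holder_bound D I g \<alpha> F L)"

text \<open>The least constant exists whenever the map is g-Hoelder.\<close>

lemma g_holder_bound_seminorm:
  assumes "g_holder D I g \<alpha> F"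
  shows "g_holder_bound D I g \<alpha> F (g_holder_seminorm D I g \<alpha> F)"
proof -
  define S where "S = {L. g_holder_bound D I g \<alpha> F L}"
  have ne: "S \<noteq> {}"
    using assms by (auto simp: S_def g_holder_def)
  have bdd: "bdd_below S"
    by (rule bdd_belowI[of _ 0]) (auto simp: S_def g_holder_bound_def)
  have "S = {0..} \<inter> (\<Inter>s\<in>I. \<Inter>t\<in>I. {L. D (F s) (F t) \<le> L * \<bar>g t - g s\<bar> powr \<alpha>})"
    by (auto simp: S_def g_holder_bound_def)
  moreover have "closed {L. D (F s) (F t) \<le> L * \<bar>g t - g s\<bar> powr \<alpha>}" for s t
    by (intro closed_Collect_le continuous_intros)
  ultimately have "closed S"
    by (auto intro!: closed_Int closed_INT)
  then have mem: "Inf S \<in> S"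
    using closed_contains_Inf[OF ne bdd] by blast
  have "(LEAST L. g_holder_bound D I g \<alpha> F L) = Inf S"
    using mem bdd by (intro Least_equality) (auto simp: S_def intro: cInf_lower)
  then show ?thesis
    using mem by (simp add: g_holder_seminorm_def S_def)
qed


section \<open>The jump constant of g\<close>

definition right_jump :: "(real \<Rightarrow> real) \<Rightarrow> real \<Rightarrow> real" where
  "right_jump g \<tau> = Lim (at_right \<tau>) g - g \<tau>"

definition max_jump :: "(real \<Rightarrow> real) \<Rightarrow> real \<Rightarrow> real \<Rightarrow> real" where
  "max_jump g s t = (SUP \<tau>\<in>{s..<t}. right_jump g \<tau>)"

definition kappa :: "real \<Rightarrow> real \<Rightarrow> (real \<Rightarrow> real) \<Rightarrow> real" where
  "kappa a b g =
     Inf {max_jump g s t / (g t - g s) | s t. a \<le> s \<and> s < t \<and> t \<le> b \<and> g s < g t}"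


section \<open>Selection properties\<close>

definition set_valued_holder_map ::
    "'x set \<Rightarrow> ('x \<Rightarrow> 'x \<Rightarrow> real) \<Rightarrow> real set \<Rightarrow> (real \<Rightarrow> real) \<Rightarrow> real \<Rightarrow> (real \<Rightarrow> 'x set) \<Rightarrow> bool" where
  "set_valued_holder_map M d I g \<alpha> F \<longleftrightarrow>
     F \<in> I \<rightarrow> compact_subsets M d \<and> g_holder (hausdorff_dist d) I g \<alpha> F"

definition selection_of :: "real set \<Rightarrow> (real \<Rightarrow> 'x set) \<Rightarrow> (real \<Rightarrow> 'x) \<Rightarrow> bool" where
  "selection_of I F f \<longleftrightarrow> (\<forall>t\<in>I. f t \<in> F t)"

text \<open>A formula of HOL cannot quantify over types, so the two properties below are indexed by a type
  \<open>'x\<close> and speak about all metric spaces whose points are elements of \<open>'x\<close>, with arbitrary carrier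
  \<open>M\<close> and arbitrary metric \<open>d\<close>.  As soon as \<open>'x\<close> has at least the cardinality of the continuum this
  is no restriction: a map from an interval to the compact subsets of a metric space only involves
  the subspace formed by the union of its values, and a union of continuum many compact
  metric spaces has at most continuum many points.\<close>

definition holder_selections :: "'x itself \<Rightarrow> real set \<Rightarrow> (real \<Rightarrow> real) \<Rightarrow> real \<Rightarrow> bool" where
  "holder_selections (_ :: 'x itself) I g \<alpha> \<longleftrightarrow>
     (\<forall>(M :: 'x set) d F. Metric_space M d \<longrightarrow> set_valued_holder_map M d I g \<alpha> F \<longrightarrow>
        (\<exists>f. selection_of I F f \<and> g_holder d I g \<alpha> f))"

definition pointed_holder_selections ::
    "'x itself \<Rightarrow> real set \<Rightarrow> (real \<Rightarrow> real) \<Rightarrow> real \<Rightarrow> real \<Rightarrow> bool" where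
  "pointed_holder_selections (_ :: 'x itself) I g \<alpha> C \<longleftrightarrow>
     (\<forall>(M :: 'x set) d F. Metric_space M d \<longrightarrow> set_valued_holder_map M d I g \<alpha> F \<longrightarrow>
        (\<forall>\<theta>\<in>I. \<forall>x\<in>F \<theta>. \<exists>f. selection_of I F f \<and> f \<theta> = x \<and> g_holder d I g \<alpha> f \<and>
           g_holder_seminorm d I g \<alpha> f \<le> C * g_holder_seminorm (hausdorff_dist d) I g \<alpha> F))"

end

theory Submission
  imports Defs
begin

text \<open>
  If \<open>kappa a b g > 0\<close>, the largest jump \<open>J s t\<close> of \<open>g\<close> between \<open>s\<close> and \<open>t\<close> is an ultrametric with
  \<open>kappa a b g * \<bar>g t - g s\<bar> \<le> J s t \<le> \<bar>g t - g s\<bar>\<close>.  Then \<open>J powr \<alpha>\<close> is an ultrametric as well,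
  and for it \<open>F\<close> is Lipschitz.  Over an ultrametric space, nearest-point choices along the tree of
  balls of dyadic radii converge geometrically to a Lipschitz selection, with the loss of a factor 8.

  If \<open>kappa a b g = 0\<close>, there are short intervals on which all jumps of \<open>g\<close> are tiny compared with the
  increment \<open>G\<close> of \<open>g\<close>.  A set of \<open>2 m\<close> equidistant points on a circle, turning with \<open>g\<close> by one
  spacing whenever \<open>g\<close> grows by \<open>G / m\<close>, is Hoelder with constant 1.  A Hoelder selection cannot change
  branch, so it reaches the antipode while \<open>g\<close> grows by \<open>G\<close>, and its Hoelder constant exceeds any given
  bound for large \<open>m\<close>.  A countable product of such maps has no Hoelder selection at all.
\<close>

subsection \<open>Jumps of monotone functions\<close>

text \<open>\<open>right_jump\<close> goes through \<open>Lim\<close>, which is informative only if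
  the limit exists. For monotone g it exists and is the infimum of g over (\<tau>, b]. The point
  \<tau> = b is excluded because g is arbitrary beyond b.\<close>

lemma mono_on_right_jump:
  fixes g :: "real \<Rightarrow> real"
  assumes mono: "mono_on {a..b} g" and \<tau>: "\<tau> \<in> {a..<b}"
  shows tendsto_right_jump: "(g \<longlongrightarrow> g \<tau> + right_jump g \<tau>) (at_right \<tau>)"
    and right_jump_nonneg: "0 \<le> right_jump g \<tau>"
    and right_jump_le: "\<And>y. y \<in> {\<tau><..b} \<Longrightarrow> right_jump g \<tau> \<le> g y - g \<tau>"
proof -
  define L where "L = Inf (g ` {\<tau><..b})"
  have ne: "g ` {\<tau><..b} \<noteq> {}" using \<tau> by auto
  have low: "g \<tau> \<le> g y" if "y \<in> {\<tau><..b}" for y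
    using that \<tau> by (intro mono_onD[OF mono]) auto
  have bdd: "bdd_below (g ` {\<tau><..b})"
    using low by (intro bdd_belowI[of _ "g \<tau>"]) auto
  have L_le: "L \<le> g y" if "y \<in> {\<tau><..b}" for y
    unfolding L_def using that bdd by (intro cInf_lower) auto
  have L_ge: "g \<tau> \<le> L"
    unfolding L_def using low ne by (intro cInf_greatest) auto
  have lim: "(g \<longlongrightarrow> L) (at_right \<tau>)"
  proof (rule order_tendstoI)
    fix c assume "c < L"
    then show "\<forall>\<^sub>F x in at_right \<tau>. c < g x"
      unfolding eventually_at_right_field using \<tau> L_le
      by (intro exI[of _ b]) force
  next
    fix c assume "L < c"
    then obtain y where y: "y \<in> {\<tau><..b}" "g y < c"
      using cInf_lessD[OF ne] unfolding L_def by blast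
    have "g z < c" if "\<tau> < z" "z < y" for z
      using mono_onD[OF mono, of z y] that y \<tau> by auto
    then show "\<forall>\<^sub>F x in at_right \<tau>. g x < c"
      unfolding eventually_at_right_field using y by (intro exI[of _ y]) auto
  qed
  have "Lim (at_right \<tau>) g = L"
    using lim by (intro tendsto_Lim) auto
  then have eq: "L = g \<tau> + right_jump g \<tau>" by (simp add: right_jump_def)
  show "(g \<longlongrightarrow> g \<tau> + right_jump g \<tau>) (at_right \<tau>)" using lim eq by simp
  show "0 \<le> right_jump g \<tau>" using L_ge eq by simp
  show "right_jump g \<tau> \<le> g y - g \<tau>" if "y \<in> {\<tau><..b}" for y
    using L_le[OF that] eq by simp
qed

text \<open>Every jump inside [s,t) fits into the increment of g, so the real-valued supremum is
  over a bounded nonempty set.\<close>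

lemma max_jump_bounds:
  fixes g :: "real \<Rightarrow> real"
  assumes mono: "mono_on {a..b} g" and st: "a \<le> s" "s < t" "t \<le> b"
  shows bdd_above_right_jump: "bdd_above (right_jump g ` {s..<t})"
    and max_jump_nonneg: "0 \<le> max_jump g s t"
    and max_jump_le: "max_jump g s t \<le> g t - g s"
proof -
  have le: "right_jump g \<tau> \<le> g t - g s" if "\<tau> \<in> {s..<t}" for \<tau>
    using right_jump_le[OF mono, of \<tau> t] mono_onD[OF mono, of s \<tau>] that st by auto
  show bdd: "bdd_above (right_jump g ` {s..<t})"
    using le by (intro bdd_aboveI2)
  have "0 \<le> right_jump g s" using right_jump_nonneg[OF mono, of s] st by simp
  also have "\<dots> \<le> max_jump g s t"
    unfolding max_jump_def using bdd st by (intro cSUP_upper) auto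
  finally show "0 \<le> max_jump g s t" .
  show "max_jump g s t \<le> g t - g s"
    unfolding max_jump_def using le st by (intro cSUP_least) auto
qed

text \<open>The source of the ultrametric inequality. With half-open intervals, a jump at u falls
  into the right-hand piece only.\<close>

lemma max_jump_split:
  fixes g :: "real \<Rightarrow> real"
  assumes mono: "mono_on {a..b} g" and "a \<le> s" "s < u" "u < t" "t \<le> b"
  shows "max_jump g s t = max (max_jump g s u) (max_jump g u t)"
proof -
  have "{s..<t} = {s..<u} \<union> {u..<t}" using assms by auto
  then show ?thesis
    unfolding max_jump_def image_Un sup_max[symmetric]
    using assms bdd_above_right_jump[OF mono]
    by (simp add: image_Un cSup_union_distrib)
qed

lemma kappa_mult_le_max_jump:
  fixes g :: "real \<Rightarrow> real"
  assumes mono: "mono_on {a..b} g" and st: "a \<le> s" "s < t" "t \<le> b"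
  shows "kappa a b g * (g t - g s) \<le> max_jump g s t"
proof (cases "g s < g t")
  case True
  have "kappa a b g \<le> max_jump g s t / (g t - g s)"
    unfolding kappa_def using st True max_jump_nonneg[OF mono]
    by (intro cInf_lower bdd_belowI[of _ 0]) auto
  then show ?thesis using True by (simp add: field_simps)
next
  case False
  moreover have "g s \<le> g t" using mono_onD[OF mono, of s t] st by simp
  ultimately show ?thesis using max_jump_nonneg[OF mono st] by simp
qed

text \<open>If all right jumps are below \<open>\<eta>\<close>, left-continuity makes \<open>g\<close> vary by less than \<open>\<eta>\<close> near
  every point, so connectedness of the interval acts as for a continuous function.\<close>

lemma small_jumps_induct:
  fixes g :: "real \<Rightarrow> real"
  assumes mono: "mono_on {a..b} g"
    and left: "\<And>t. t \<in> {a<..b} \<Longrightarrow> continuous (at_left t) g"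
    and st: "a \<le> s" "s \<le> t" "t \<le> b"
    and jump: "\<And>\<tau>. \<tau> \<in> {s..<t} \<Longrightarrow> right_jump g \<tau> < \<eta>"
    and "0 < \<eta>"
    and R: "\<And>x y. x \<in> {s..t} \<Longrightarrow> y \<in> {s..t} \<Longrightarrow> \<bar>g x - g y\<bar> < \<eta> \<Longrightarrow> R x y"
    and sym: "\<And>x y. R x y \<Longrightarrow> R y x"
    and trans: "\<And>x y z. R x y \<Longrightarrow> R y z \<Longrightarrow> R x z"
  shows "R s t"
proof (rule connected_equivalence_relation[of "{s..t}"])
  fix x assume x: "x \<in> {s..t}"
  \<comment> \<open>On the left of x, left-continuity suffices; at x = s no point of the interval
    lies to the left.\<close>
  have L: "\<exists>l<x. \<forall>y. l < y \<and> y \<le> x \<and> y \<in> {s..t} \<longrightarrow> \<bar>g x - g y\<bar> < \<eta>"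
  proof (cases "x = s")
    case True
    then show ?thesis using \<open>0 < \<eta>\<close> by (intro exI[of _ "x - 1"]) auto
  next
    case False
    then have "(g \<longlongrightarrow> g x) (at_left x)"
      using left[of x] x st by (simp add: continuous_within)
    then have "\<forall>\<^sub>F y in at_left x. dist (g y) (g x) < \<eta>"
      using \<open>0 < \<eta>\<close> by (rule tendstoD)
    then obtain l where "l < x" "\<forall>y>l. y < x \<longrightarrow> dist (g y) (g x) < \<eta>"
      unfolding eventually_at_left_field by blast
    then show ?thesis using \<open>0 < \<eta>\<close>
      by (intro exI[of _ l]) (auto simp: dist_real_def less_le abs_minus_commute)
  qed
  \<comment> \<open>On the right of x the limit of g is g x plus a jump below \<eta>, and
    monotonicity excludes values below g x. No bound on the jump at t is available, but the interval
    ends there.\<close>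
  have U: "\<exists>r>x. \<forall>y. x \<le> y \<and> y < r \<and> y \<in> {s..t} \<longrightarrow> \<bar>g x - g y\<bar> < \<eta>"
  proof (cases "x = t")
    case True
    then show ?thesis using \<open>0 < \<eta>\<close> by (intro exI[of _ "x + 1"]) auto
  next
    case False
    then have xs: "x \<in> {s..<t}" "x \<in> {a..<b}" using x st by auto
    have "\<forall>\<^sub>F y in at_right x. g y < g x + \<eta>"
      using order_tendstoD(2)[OF tendsto_right_jump[OF mono xs(2)], of "g x + \<eta>"] jump[OF xs(1)] 
      by simp
    then obtain r where r: "r > x" "\<forall>y>x. y < r \<longrightarrow> g y < g x + \<eta>"
      unfolding eventually_at_right_field by blast
    have "\<bar>g x - g y\<bar> < \<eta>" if "x \<le> y \<and> y < r \<and> y \<in> {s..t}" for y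
    proof -
      have "g x \<le> g y" using mono_onD[OF mono, of x y] that x st by auto
      then show ?thesis using r(2)[rule_format, of y] that \<open>0 < \<eta>\<close> by (cases "x = y") auto
    qed
    then show ?thesis using r by blast
  qed
  from L U obtain l r where lr: "l < x" "x < r"
    "\<forall>y. l < y \<and> y \<le> x \<and> y \<in> {s..t} \<longrightarrow> \<bar>g x - g y\<bar> < \<eta>"
    "\<forall>y. x \<le> y \<and> y < r \<and> y \<in> {s..t} \<longrightarrow> \<bar>g x - g y\<bar> < \<eta>" by blast
  show "\<exists>T. openin (top_of_set {s..t}) T \<and> x \<in> T \<and> (\<forall>y\<in>T. R x y)"
  proof (intro exI conjI ballI)
    show "openin (top_of_set {s..t}) ({s..t} \<inter> {l<..<r})"
      by (intro openin_open_Int) auto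
    show "R x y" if "y \<in> {s..t} \<inter> {l<..<r}" for y
    proof (rule R)
      show "\<bar>g x - g y\<bar> < \<eta>" using lr(3,4)[rule_format, of y] that by (cases "x \<le> y") auto
    qed (use x that in auto)
  qed (use lr x in auto)
next
  show "connected {s..t}" by (rule connected_Icc)
  show "s \<in> {s..t}" "t \<in> {s..t}" using st by auto
qed (use sym trans in blast)+

text \<open>A pair with small jump ratio may have an increment larger than D. Its right endpoint is
  moved left until the increment is at most D, yet still a fixed fraction of the old one, so that
  the jumps stay relatively small.\<close>

lemma small_jump_interval:
  fixes g :: "real \<Rightarrow> real"
  assumes "a < b" and nconst: "\<not> g constant_on {a..b}"
    and left: "\<And>t. t \<in> {a<..b} \<Longrightarrow> continuous (at_left t) g"
    and mono: "mono_on {a..b} g"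
    and \<kappa>: "\<not> 0 < kappa a b g" and "0 < \<epsilon>" "0 < D"
  obtains s t where "a \<le> s" "s < t" "t \<le> b" "0 < g t - g s" "g t - g s \<le> D"
    "\<And>\<tau>. \<tau> \<in> {s..<t} \<Longrightarrow> right_jump g \<tau> < \<epsilon> * (g t - g s)"
proof -
  define V where "V = g b - g a"
  obtain x y where xy: "x \<in> {a..b}" "y \<in> {a..b}" "g x \<noteq> g y"
    using nconst unfolding constant_on_def by blast
  have ab: "g a \<le> g x" "g x \<le> g b" "g a \<le> g y" "g y \<le> g b"
    using xy by (auto intro!: mono_onD[OF mono])
  then have "0 < V" unfolding V_def using xy by linarith
  \<comment> \<open>The shrinking factor: no increment of g exceeds V, so \<rho> times an increment
    is at most D. The threshold \<epsilon>' already pays for the shrinking, by the factor \<rho>,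
    and for an error of one half.\<close>
  define \<rho> where "\<rho> = min 1 (D / V)"
  define \<epsilon>' where "\<epsilon>' = \<rho> * min \<epsilon> 1 / 2"
  have \<rho>: "0 < \<rho>" "\<rho> \<le> 1" "\<rho> * V \<le> D"
    using \<open>0 < V\<close> \<open>0 < D\<close> by (auto simp: \<rho>_def min_def field_simps)
  have "0 < \<epsilon>'" using \<rho> \<open>0 < \<epsilon>\<close> by (simp add: \<epsilon>'_def)
  have "Inf {max_jump g s t / (g t - g s) | s t. a \<le> s \<and> s < t \<and> t \<le> b \<and> g s < g t} < \<epsilon>'"
    using \<kappa> \<open>0 < \<epsilon>'\<close> unfolding kappa_def by linarith
  moreover have ne: "{max_jump g s t / (g t - g s) | s t. a \<le> s \<and> s < t \<and> t \<le> b \<and> g s < g t} \<noteq> {}"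
    using \<open>a < b\<close> \<open>0 < V\<close> unfolding V_def by force
  ultimately obtain s t0 where st0: "a \<le> s" "s < t0" "t0 \<le> b" "g s < g t0"
    "max_jump g s t0 / (g t0 - g s) < \<epsilon>'"
    using cInf_lessD[OF ne] by blast
  define G where "G = g t0 - g s"
  define \<eta> where "\<eta> = \<epsilon>' * G"
  have "0 < G" using st0 by (simp add: G_def)
  then have "0 < \<eta>" using \<open>0 < \<epsilon>'\<close> by (simp add: \<eta>_def)
  have jump: "right_jump g \<tau> < \<eta>" if "\<tau> \<in> {s..<t0}" for \<tau>
  proof -
    have "right_jump g \<tau> \<le> max_jump g s t0"
      unfolding max_jump_def using that bdd_above_right_jump[OF mono] st0
      by (intro cSUP_upper) auto
    also have "\<dots> < \<eta>" using st0 by (simp add: \<eta>_def G_def field_simps)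
    finally show ?thesis .
  qed
  define \<delta> where "\<delta> = \<rho> * G"
  have \<eta>\<delta>: "\<eta> = \<delta> * min \<epsilon> 1 / 2" by (simp add: \<eta>_def \<delta>_def \<epsilon>'_def)
  have "0 < \<delta>" using \<rho> \<open>0 < G\<close> by (simp add: \<delta>_def)
  have "\<delta> \<le> G" using \<rho> \<open>0 < G\<close> by (simp add: \<delta>_def)
  have "G \<le> V" using mono_onD[OF mono, of a s] mono_onD[OF mono, of t0 b] st0
    by (simp add: G_def V_def)
  then have "\<rho> * G \<le> \<rho> * V" using \<rho> by (intro mult_left_mono) auto
  then have "\<delta> \<le> D" using \<rho> unfolding \<delta>_def by linarith
  have "\<eta> \<le> \<delta> / 2" using \<open>0 < \<delta>\<close> by (simp add: \<eta>\<delta> mult_left_le)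
  \<comment> \<open>An intermediate value theorem up to the jump size: if g skipped the window of
    width \<eta>, steps smaller than \<eta> could never cross it, and the increment would stay at
    most \<delta> up to t0. Then it equals \<delta> at t0, which lies in the window.\<close>
  have "\<exists>t\<in>{s..t0}. g t - g s \<in> {\<delta> - \<eta>..\<delta>}"
  proof (rule ccontr)
    assume no: "\<not> ?thesis"
    have step: "(g x - g s \<le> \<delta>) = (g y - g s \<le> \<delta>)"
      if "x \<in> {s..t0}" "y \<in> {s..t0}" "\<bar>g x - g y\<bar> < \<eta>" for x y
    proof -
      have out: "g z - g s < \<delta> - \<eta> \<or> \<delta> < g z - g s" if "z \<in> {s..t0}" for z
        using no that by (meson atLeastAtMost_iff not_le)
      show ?thesis using out[of x] out[of y] that(3) that(1,2) by linarith
    qed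
    have "(g s - g s \<le> \<delta>) = (g t0 - g s \<le> \<delta>)"
    proof (rule small_jumps_induct[OF mono left, where R="\<lambda>x y. (g x - g s \<le> \<delta>) = (g y - g s \<le> \<delta>)"])
      show "s \<le> t0" using st0 by simp
    qed (fact st0 jump \<open>0 < \<eta>\<close> step | assumption | metis)+
    then have "g t0 - g s \<le> \<delta>" using \<open>0 < \<delta>\<close> by simp
    then have "g t0 - g s = \<delta>" using \<open>\<delta> \<le> G\<close> by (simp add: G_def)
    then have "g t0 - g s \<in> {\<delta> - \<eta>..\<delta>}" "t0 \<in> {s..t0}" using st0(2) \<open>0 < \<eta>\<close> by auto
    then show False using no by blast
  qed
  then obtain t where t: "t \<in> {s..t0}" "\<delta> - \<eta> \<le> g t - g s" "g t - g s \<le> \<delta>" by auto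
  have pos: "\<delta> / 2 \<le> g t - g s" using t \<open>\<eta> \<le> \<delta> / 2\<close> by linarith
  have "\<eta> \<le> \<epsilon> * (\<delta> / 2)" using \<open>0 < \<delta>\<close> by (simp add: \<eta>\<delta>)
  also have "\<dots> \<le> \<epsilon> * (g t - g s)" using pos \<open>0 < \<epsilon>\<close> by (intro mult_left_mono) auto
  finally have le: "\<eta> \<le> \<epsilon> * (g t - g s)" .
  show thesis
  proof (rule that[of s t])
    show "s < t" using pos \<open>0 < \<delta>\<close> t(1) by (cases "s = t") auto
    show "right_jump g \<tau> < \<epsilon> * (g t - g s)" if "\<tau> \<in> {s..<t}" for \<tau>
      using jump[of \<tau>] that t(1) le by auto
  qed (use st0 t pos \<open>0 < \<delta>\<close> \<open>\<delta> \<le> D\<close> in auto)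
qed

subsection \<open>Selections over ultrametric spaces\<close>

text \<open>\<open>LEAST\<close> on the reals is meaningful only if the infimum is attained. It is
  attained here: pairs with g s = g t give a condition free of the constant, since
  \<open>0 powr \<alpha> = 0\<close>, and every other pair bounds all admissible constants below by
  a quotient.\<close>

lemma g_holder_seminorm_le:
  assumes "g_holder_bound D I g \<alpha> F L"
  shows "g_holder_seminorm D I g \<alpha> F \<le> L"
proof -
  define S where "S = {L. g_holder_bound D I g \<alpha> F L}"
  have ne: "S \<noteq> {}" and bdd: "bdd_below S"
    using assms by (auto simp: S_def g_holder_bound_def intro!: bdd_belowI[of _ 0])
  have "Inf S \<in> S"
  proof -
    have "D (F s) (F t) \<le> Inf S * \<bar>g t - g s\<bar> powr \<alpha>" if st: "s \<in> I" "t \<in> I" for s t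
    proof (cases "g t = g s")
      case True
      then show ?thesis using assms st by (fastforce simp: g_holder_bound_def)
    next
      case False
      have "D (F s) (F t) / \<bar>g t - g s\<bar> powr \<alpha> \<le> Inf S"
        using ne False st by (intro cInf_greatest) (auto simp: S_def g_holder_bound_def field_simps)
      then show ?thesis using False by (simp add: field_simps)
    qed
    moreover have "0 \<le> Inf S"
      using ne by (intro cInf_greatest) (auto simp: S_def g_holder_bound_def)
    ultimately show ?thesis by (auto simp: S_def g_holder_bound_def)
  qed
  then have "g_holder_seminorm D I g \<alpha> F = Inf S"
    unfolding g_holder_seminorm_def using bdd
    by (intro Least_equality) (auto simp: S_def intro: cInf_lower)
  also have "\<dots> \<le> L" using assms bdd by (auto simp: S_def intro: cInf_lower)
  finally show ?thesis .
qed

lemma powr_max_distrib: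
  fixes x y p :: real
  assumes "0 \<le> x" "0 \<le> y" "0 \<le> p"
  shows "max x y powr p = max (x powr p) (y powr p)"
  using powr_mono2[of p x y] powr_mono2[of p y x] assms by (auto simp: max_def)

section \<open>Nearest points, Hausdorff distance and selections in a metric space\<close>

context Metric_space
begin

lemma compact_subsets_subset: "A \<in> compact_subsets M d \<Longrightarrow> A \<subseteq> M"
  using compactin_subset_topspace by (fastforce simp: compact_subsets_def)

text \<open>A minimising sequence in A has a convergent subsequence, whose limit attains the
  infimum.\<close>

lemma compact_subset_nearest_point:
  assumes A: "A \<in> compact_subsets M d" and "x \<in> M"
  obtains y where "y \<in> A" "d x y = dist_to_set d x A"
proof -
  have cA: "compactin mtopology A" and neA: "A \<noteq> {}" and AM: "A \<subseteq> M"
    using A compact_subsets_subset by (auto simp: compact_subsets_def)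
  have bdd: "bdd_below (d x ` A)" by (intro bdd_belowI2[of _ 0]) auto
  have "\<exists>y. y \<in> A \<and> d x y < dist_to_set d x A + inverse (real (Suc n))" for n
    using cInf_lessD[of "d x ` A" "dist_to_set d x A + inverse (real (Suc n))"] neA
    by (auto simp: dist_to_set_def)
  then obtain \<sigma> where \<sigma>: "\<And>n. \<sigma> n \<in> A" "\<And>n. d x (\<sigma> n) < dist_to_set d x A + inverse (real (Suc n))"
    by metis
  then obtain l r where l: "l \<in> A" "strict_mono r" "limitin mtopology (\<sigma> \<circ> r) l sequentially"
    using cA unfolding compactin_sequentially by (metis image_subsetI)
  have lM: "l \<in> M" using l AM by auto
  have le: "dist_to_set d x A \<le> d x l"
    unfolding dist_to_set_def using bdd l by (intro cINF_lower) auto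
  have lim1: "(\<lambda>n. d ((\<sigma> \<circ> r) n) l) \<longlonglongrightarrow> 0"
    using l(3) by (simp add: limitin_metric_dist_null)
  have lim2: "(\<lambda>n. inverse (real (Suc (r n)))) \<longlonglongrightarrow> 0"
    using LIMSEQ_subseq_LIMSEQ[OF LIMSEQ_inverse_real_of_nat l(2)] by (simp add: o_def)
  have "(\<lambda>n. dist_to_set d x A + inverse (real (Suc (r n))) + d ((\<sigma> \<circ> r) n) l)
      \<longlonglongrightarrow> dist_to_set d x A + 0 + 0"
    by (intro tendsto_add tendsto_const lim1 lim2)
  moreover have "d x l \<le> dist_to_set d x A + inverse (real (Suc (r n))) + d ((\<sigma> \<circ> r) n) l" for n
    using triangle[of x "\<sigma> (r n)" l] \<sigma>[of "r n"] AM lM \<open>x \<in> M\<close> by fastforce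
  ultimately have "d x l \<le> dist_to_set d x A"
    by (intro LIMSEQ_le_const) auto
  with le l show thesis by (intro that[of l]) auto
qed

text \<open>The supremum in \<open>hausdorff_dist\<close> dominates its members only when they are
  bounded above; compact sets are metrically bounded, which provides this.\<close>

lemma dist_to_set_le_hausdorff_dist:
  assumes A: "A \<in> compact_subsets M d" and B: "B \<in> compact_subsets M d" and "x \<in> A"
  shows "dist_to_set d x B \<le> hausdorff_dist d A B"
proof -
  have cA: "compactin mtopology A" "A \<subseteq> M" and B': "B \<noteq> {}" "B \<subseteq> M"
    using A B compact_subsets_subset by (auto simp: compact_subsets_def)
  obtain y where y: "y \<in> B" "y \<in> M" using B' by auto
  obtain c r where cr: "A \<subseteq> mcball c r"
    using compactin_imp_mbounded[OF cA(1)] unfolding mbounded_def by blast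
  have "dist_to_set d x' B \<le> r + d c y" if "x' \<in> A" for x'
  proof -
    have "dist_to_set d x' B \<le> d x' y"
      unfolding dist_to_set_def using y by (intro cINF_lower bdd_belowI2[of _ 0]) auto
    also have "\<dots> \<le> d x' c + d c y" using cr that y by (intro triangle) auto
    also have "d x' c \<le> r" using cr that by (auto simp: commute)
    finally show ?thesis by simp
  qed
  then have "bdd_above ((\<lambda>x. dist_to_set d x B) ` A)" by (intro bdd_aboveI2)
  then have "dist_to_set d x B \<le> (SUP x\<in>A. dist_to_set d x B)"
    using \<open>x \<in> A\<close> by (intro cSUP_upper)
  then show ?thesis by (simp add: hausdorff_dist_def)
qed

text \<open>Discretising the ultrametric \<open>\<rho>\<close> at the scales \<open>R / 2 ^ n\<close>, every class of scale \<open>n\<close> gets a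
  centre \<open>c n\<close> and a value \<open>v n\<close>, each value being a nearest point to the value one scale above.\<close>

lemma ultrametric_lipschitz_selection:
  fixes \<rho> :: "'i \<Rightarrow> 'i \<Rightarrow> real"
  assumes refl: "\<And>x. x \<in> I \<Longrightarrow> \<rho> x x = 0"
    and sym: "\<And>x y. x \<in> I \<Longrightarrow> y \<in> I \<Longrightarrow> \<rho> x y = \<rho> y x"
    and ultra: "\<And>x y z. x \<in> I \<Longrightarrow> y \<in> I \<Longrightarrow> z \<in> I \<Longrightarrow> \<rho> x z \<le> max (\<rho> x y) (\<rho> y z)"
    and bound: "\<And>x y. x \<in> I \<Longrightarrow> y \<in> I \<Longrightarrow> \<rho> x y \<le> R"
    and "0 \<le> K"
    and F: "\<And>x. x \<in> I \<Longrightarrow> F x \<in> compact_subsets M d"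
    and lip: "\<And>x y. x \<in> I \<Longrightarrow> y \<in> I \<Longrightarrow> hausdorff_dist d (F x) (F y) \<le> K * \<rho> x y"
    and \<theta>: "\<theta> \<in> I" "x\<^sub>\<theta> \<in> F \<theta>"
  obtains f where "\<And>x. x \<in> I \<Longrightarrow> f x \<in> F x" "f \<theta> = x\<^sub>\<theta>"
    "\<And>x y. x \<in> I \<Longrightarrow> y \<in> I \<Longrightarrow> d (f x) (f y) \<le> 8 * K * \<rho> x y"
proof -
  have \<rho>_nonneg: "0 \<le> \<rho> x y" if "x \<in> I" "y \<in> I" for x y
    using ultra[of x y x] refl[of x] sym[of x y] that by simp
  have "0 \<le> R" using bound[OF \<theta>(1) \<theta>(1)] refl[OF \<theta>(1)] by simp
  have FM: "y \<in> M" if "x \<in> I" "y \<in> F x" for x y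
    using F[of x] that compact_subsets_subset by blast
  \<comment> \<open>Closed balls of an ultrametric with equal radius coincide or are disjoint, so
    \<open>cl n\<close> partitions I. At n = 0 there is a single class, since \<rho> is at most
    R.\<close>
  define cl where "cl n x = {y \<in> I. \<rho> x y \<le> R / 2 ^ n}" for n x
  \<comment> \<open>The centre depends on x only through its class, and \<theta> is preferred so
    that the value at \<theta> never moves.\<close>
  define c where "c n x = (if \<theta> \<in> cl n x then \<theta> else SOME y. y \<in> cl n x)" for n x
  define nr where "nr p x = (SOME y. y \<in> F x \<and> d p y = dist_to_set d p (F x))" for p x
  define v where "v = rec_nat (\<lambda>x. x\<^sub>\<theta>) (\<lambda>n w x. nr (w x) (c (Suc n) x))"
  have v0: "v 0 x = x\<^sub>\<theta>" for x by (simp add: v_def)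
  have vS: "v (Suc n) x = nr (v n x) (c (Suc n) x)" for n x by (simp add: v_def)
  have Rn: "0 \<le> R / 2 ^ n" for n using \<open>0 \<le> R\<close> by simp
  have self: "x \<in> cl n x" if "x \<in> I" for n x
    using that refl Rn by (simp add: cl_def)
  have c_cl: "c n x \<in> cl n x" if "x \<in> I" for n x
    using someI[of "\<lambda>y. y \<in> cl n x", OF self[OF that]] by (simp add: c_def)
  have c_I: "c n x \<in> I" if "x \<in> I" for n x using c_cl[OF that] by (simp add: cl_def)
  have cl_subset: "cl n x \<subseteq> cl n y" if "x \<in> I" "y \<in> I" "\<rho> x y \<le> R / 2 ^ n" for n x y
    using that ultra[of y x] sym[of x y] by (force simp: cl_def)
  have cl_eq: "cl n x = cl n y" if "x \<in> I" "y \<in> I" "\<rho> x y \<le> R / 2 ^ n" for n x y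
    using cl_subset[of x y n] cl_subset[of y x n] that sym[of x y] by auto
  have v_eq: "v n x = v n y" if "x \<in> I" "y \<in> I" "\<rho> x y \<le> R / 2 ^ n" for n x y
    using that
  proof (induction n)
    case 0
    then show ?case by (simp add: v0)
  next
    case (Suc n)
    have "R / 2 ^ Suc n \<le> R / 2 ^ n" using \<open>0 \<le> R\<close> by (simp add: field_simps)
    with Suc have "v n x = v n y" by auto
    moreover have "c (Suc n) x = c (Suc n) y"
      unfolding c_def cl_eq[OF Suc.prems] ..
    ultimately show ?case by (simp add: vS)
  qed
  have nr: "nr p x \<in> F x \<and> d p (nr p x) = dist_to_set d p (F x)" if "p \<in> M" "x \<in> I" for p x
    unfolding nr_def using compact_subset_nearest_point[OF F[OF that(2)] that(1)]
    by (metis (mono_tags, lifting) someI_ex)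
  have v_in: "v n x \<in> F (c n x)" if "x \<in> I" for n x
  proof (induction n)
    case 0
    have "c 0 x = \<theta>" using bound that \<theta> by (simp add: c_def cl_def)
    then show ?case by (simp add: v0 \<theta>)
  next
    case (Suc n)
    show ?case unfolding vS
      using nr[OF FM[OF c_I[OF that] Suc] c_I[OF that]] by simp
  qed
  have vM: "v n x \<in> M" if "x \<in> I" for n x using FM[OF c_I v_in] that by blast
  have near: "dist_to_set d (v n x) (F y) \<le> K * (R / 2 ^ n)"
    if "x \<in> I" "y \<in> cl n x" for n x y
  proof -
    have yI: "y \<in> I" using that by (simp add: cl_def)
    have "\<rho> (c n x) y \<le> R / 2 ^ n"
      using ultra[of "c n x" x y] c_cl[OF that(1), of n] that sym[of "c n x" x]
      by (auto simp: cl_def max_def split: if_splits)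
    then have "K * \<rho> (c n x) y \<le> K * (R / 2 ^ n)"
      using \<open>0 \<le> K\<close> by (intro mult_left_mono)
    then show ?thesis
      using dist_to_set_le_hausdorff_dist[OF F F v_in[OF that(1)]] lip[of "c n x" y] c_I[OF that(1)] yI
      by (meson order_trans)
  qed
  have cl_Suc: "cl (Suc n) x \<subseteq> cl n x" for n x
    using \<open>0 \<le> R\<close> by (auto simp: cl_def field_simps)
  have step: "d (v n x) (v (Suc n) x) \<le> K * (R / 2 ^ n)" if "x \<in> I" for n x
  proof -
    have "c (Suc n) x \<in> cl n x" using c_cl[OF that] cl_Suc by blast
    from near[OF that this] show ?thesis
      using nr[OF vM[OF that] c_I[OF that]] by (simp add: vS)
  qed
  \<comment> \<open>The geometric sum of the steps in closed form. The subtracted tail is kept, as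
    it later absorbs the last move from \<open>v (n + j) x\<close> into F x.\<close>
  have chain: "d (v n x) (v (n + j) x) \<le> 2 * K * (R / 2 ^ n) - 2 * K * (R / 2 ^ (n + j))"
    if "x \<in> I" for n j x
  proof (induction j)
    case 0
    then show ?case using vM[OF that] by simp
  next
    case (Suc j)
    have "d (v n x) (v (n + Suc j) x) \<le> d (v n x) (v (n + j) x) + d (v (n + j) x) (v (n + Suc j) x)"
      using vM[OF that] by (intro triangle)
    also have "d (v (n + j) x) (v (n + Suc j) x) \<le> K * (R / 2 ^ (n + j))"
      using step[OF that] by simp
    also have "K * (R / 2 ^ (n + j)) = 2 * K * (R / 2 ^ (n + j)) - 2 * K * (R / 2 ^ (n + Suc j))"
      by simp
    finally show ?case using Suc by linarith
  qed
  have lim: "\<exists>l. l \<in> F x \<and> (\<forall>n. d (v n x) l \<le> 2 * K * (R / 2 ^ n))" if x: "x \<in> I" for x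
  proof -
    \<comment> \<open>\<open>v n x\<close> lies in the set over the centre of its class rather than
      in F x. Projecting to F x makes compactness of F x applicable, and a limit point of the
      projections is the value of the selection.\<close>
    define p where "p n = nr (v n x) x" for n
    have p: "p n \<in> F x" "d (v n x) (p n) \<le> K * (R / 2 ^ n)" for n
      using nr[OF vM[OF x] x] near[OF x self[OF x]] by (auto simp: p_def)
    then obtain l r where l: "l \<in> F x" "strict_mono r" "limitin mtopology (p \<circ> r) l sequentially"
      using F[OF x] unfolding compact_subsets_def compactin_sequentially by blast
    have lM: "l \<in> M" and pM: "p n \<in> M" for n using FM x l p by auto
    have lim1: "(\<lambda>j. d ((p \<circ> r) j) l) \<longlonglongrightarrow> 0"
      using l(3) by (simp add: limitin_metric_dist_null)
    have "d (v n x) l \<le> 2 * K * (R / 2 ^ n)" for n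
    proof (rule LIMSEQ_le_const)
      show "(\<lambda>j. 2 * K * (R / 2 ^ n) + d ((p \<circ> r) j) l) \<longlonglongrightarrow> 2 * K * (R / 2 ^ n)"
        using tendsto_add[OF tendsto_const lim1] by simp
      show "\<exists>N. \<forall>j\<ge>N. d (v n x) l \<le> 2 * K * (R / 2 ^ n) + d ((p \<circ> r) j) l"
      proof (intro exI allI impI)
        fix j assume "n \<le> j"
        then have "n \<le> r j" using seq_suble[OF l(2), of j] by simp
        then obtain k where k: "r j = n + k" using le_Suc_ex by blast
        have "d (v n x) l \<le> d (v n x) (v (r j) x) + d (v (r j) x) (p (r j)) + d (p (r j)) l"
          using triangle[of "v n x" "v (r j) x" l] triangle[of "v (r j) x" "p (r j)" l] vM[OF x] pM lM
          by fastforce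
        moreover have "d (v n x) (v (r j) x) \<le> 2 * K * (R / 2 ^ n) - 2 * K * (R / 2 ^ r j)"
          using chain[OF x, of n k] k by simp
        moreover have "0 \<le> K * (R / 2 ^ r j)" using \<open>0 \<le> K\<close> Rn by (intro mult_nonneg_nonneg)
        ultimately show "d (v n x) l \<le> 2 * K * (R / 2 ^ n) + d ((p \<circ> r) j) l"
          using p(2)[of "r j"] by simp
      qed
    qed
    then show ?thesis using l by blast
  qed
  then obtain f where f: "\<And>x. x \<in> I \<Longrightarrow> f x \<in> F x"
    "\<And>x n. x \<in> I \<Longrightarrow> d (v n x) (f x) \<le> 2 * K * (R / 2 ^ n)" by metis
  \<comment> \<open>Within a class of scale n the values \<open>v n\<close> agree, so the distance
    is at most twice the error at that scale.\<close>
  have close: "d (f x) (f y) \<le> 4 * K * (R / 2 ^ n)"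
    if "x \<in> I" "y \<in> I" "\<rho> x y \<le> R / 2 ^ n" for n x y
    using triangle[of "f x" "v n x" "f y"] f(2)[of x n] f(2)[of y n] v_eq[OF that] vM FM[OF _ f(1)] that
    by (simp add: commute)
  have small: "(\<lambda>n. C * (R / 2 ^ n)) \<longlonglongrightarrow> 0" for C :: real
    using tendsto_mult_left[OF LIMSEQ_inverse_realpow_zero[of 2], of "C * R"] by (simp add: field_simps)
  show thesis
  proof (rule that[of f])
    \<comment> \<open>The centre of the class of \<theta> is \<theta> at every scale, and the only
      nearest point of F \<theta> to \<open>x\<^sub>\<theta>\<close> is
      \<open>x\<^sub>\<theta>\<close> itself.\<close>
    have v\<theta>: "v n \<theta> = x\<^sub>\<theta>" for n
    proof (induction n)
      case (Suc n)
      have c: "c (Suc n) \<theta> = \<theta>" using self[OF \<theta>(1)] by (simp add: c_def)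
      have xM: "x\<^sub>\<theta> \<in> M" using FM \<theta> by blast
      have "dist_to_set d x\<^sub>\<theta> (F \<theta>) \<le> d x\<^sub>\<theta> x\<^sub>\<theta>"
        unfolding dist_to_set_def using \<theta> by (intro cINF_lower bdd_belowI2[of _ 0]) auto
      then have "d x\<^sub>\<theta> (nr x\<^sub>\<theta> \<theta>) \<le> 0" using nr[OF xM \<theta>(1)] xM by simp
      then have "nr x\<^sub>\<theta> \<theta> = x\<^sub>\<theta>"
        using nr[OF xM \<theta>(1)] xM FM[OF \<theta>(1)] nonneg zero by (metis order_antisym)
      then show ?case by (simp add: vS c Suc)
    qed (simp add: v0)
    have "d x\<^sub>\<theta> (f \<theta>) \<le> 0"
      using f(2)[OF \<theta>(1)] unfolding v\<theta> by (intro LIMSEQ_le_const[OF small[of "2 * K"]]) auto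
    then show "f \<theta> = x\<^sub>\<theta>"
      using FM[OF \<theta>(1)] \<theta>(2) f(1)[OF \<theta>(1)] nonneg zero by (metis order_antisym)
    show "d (f x) (f y) \<le> 8 * K * \<rho> x y" if "x \<in> I" "y \<in> I" for x y
    proof (cases "\<rho> x y = 0")
      case True
      then have "d (f x) (f y) \<le> 0"
        using close[OF that] Rn by (intro LIMSEQ_le_const[OF small[of "4 * K"]]) auto
      then show ?thesis using True by simp
    next
      case False
      then have pos: "0 < \<rho> x y" using \<rho>_nonneg[OF that] by simp
      have "\<exists>n. R / 2 ^ n < \<rho> x y"
        using order_tendstoD(2)[OF small[of 1] pos] by (auto simp: eventually_sequentially)
      \<comment> \<open>The first scale that separates x and y. One scale above they share a class,
        and halving the radius turns the factor 4 into 8.\<close>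
      define n where "n = (LEAST n. R / 2 ^ n < \<rho> x y)"
      have n: "R / 2 ^ n < \<rho> x y"
        unfolding n_def using \<open>\<exists>n. R / 2 ^ n < \<rho> x y\<close> by (rule LeastI_ex)
      have "n \<noteq> 0" using n bound[OF that] by (intro notI) simp
      then obtain k where k: "n = Suc k" by (cases n) auto
      then have "\<rho> x y \<le> R / 2 ^ k"
        using not_less_Least[of k "\<lambda>n. R / 2 ^ n < \<rho> x y"] unfolding n_def by simp
      then have "d (f x) (f y) \<le> 4 * K * (R / 2 ^ k)" by (rule close[OF that])
      also have "\<dots> = 8 * K * (R / 2 ^ n)" by (simp add: k)
      also have "\<dots> \<le> 8 * K * \<rho> x y" using n \<open>0 \<le> K\<close> by (intro mult_left_mono) auto
      finally show ?thesis .
    qed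
  qed (use f in auto)
qed

end

text \<open>The lower comparison of J with g makes F Lipschitz for \<open>J powr \<alpha>\<close> at
  the cost of \<open>kappa a b g powr (-\<alpha>)\<close>; the upper comparison turns the Lipschitz
  selection back into a g-Hoelder one without further loss.\<close>

lemma kappa_pos_imp_pointed_holder_selections:
  fixes g :: "real \<Rightarrow> real"
  assumes "0 < \<alpha>" and mono: "mono_on {a..b} g" and \<kappa>: "0 < kappa a b g"
  shows "pointed_holder_selections TYPE('x) {a..b} g \<alpha> (8 * kappa a b g powr (-\<alpha>))"
  unfolding pointed_holder_selections_def
proof (intro allI impI ballI)
  fix M :: "'x set" and d F \<theta> x\<^sub>\<theta>
  assume "Metric_space M d" and SF: "set_valued_holder_map M d {a..b} g \<alpha> F"
    and \<theta>: "\<theta> \<in> {a..b}" "x\<^sub>\<theta> \<in> F \<theta>"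
  interpret Metric_space M d by fact
  define L where "L = g_holder_seminorm (hausdorff_dist d) {a..b} g \<alpha> F"
  have F: "F t \<in> compact_subsets M d" if "t \<in> {a..b}" for t
    using SF that by (auto simp: set_valued_holder_map_def)
  have L: "g_holder_bound (hausdorff_dist d) {a..b} g \<alpha> F L"
    using SF unfolding L_def set_valued_holder_map_def by (intro g_holder_bound_seminorm) simp
  define J where "J s t = (if s < t then max_jump g s t else if t < s then max_jump g t s else 0)" for s t
  define K where "K = L * kappa a b g powr (-\<alpha>)"
  have "0 \<le> L" using L by (simp add: g_holder_bound_def)
  then have "0 \<le> K" by (simp add: K_def)
  have J0: "0 \<le> J s t" if "s \<in> {a..b}" "t \<in> {a..b}" for s t
    using that max_jump_nonneg[OF mono] by (auto simp: J_def)
  have J_le: "J s t \<le> \<bar>g t - g s\<bar>" if "s \<in> {a..b}" "t \<in> {a..b}" for s t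
    using that max_jump_le[OF mono, of s t] max_jump_le[OF mono, of t s] by (auto simp: J_def)
  have J_ge: "kappa a b g * \<bar>g t - g s\<bar> \<le> J s t" if "s \<in> {a..b}" "t \<in> {a..b}" for s t
    using that kappa_mult_le_max_jump[OF mono, of s t] kappa_mult_le_max_jump[OF mono, of t s]
      mono_onD[OF mono, of s t] mono_onD[OF mono, of t s]
    by (auto simp: J_def abs_if)
  have J_ultra: "J x z \<le> max (J x y) (J y z)"
    if "x \<in> {a..b}" "y \<in> {a..b}" "z \<in> {a..b}" for x y z
  proof -
    have split: "J s t = max (J s u) (J u t)" if "s < u" "u < t" "s \<in> {a..b}" "t \<in> {a..b}" for s u t
      using max_jump_split[OF mono, of s u t] that by (simp add: J_def)
    have sym: "J s t = J t s" for s t by (simp add: J_def)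
    \<comment> \<open>If y lies between x and z, splitting gives equality. If y lies outside, J x z
      is one of the two pieces of J x y or of J y z.\<close>
    consider "x = y \<or> y = z \<or> x = z" | "x < y" "y < z" | "z < y" "y < x" | "y < x" "x < z"
      | "y < z" "z < x" | "x < z" "z < y" | "z < x" "x < y" by linarith
    then show ?thesis
    proof cases
      case 1
      then show ?thesis using J0[of x y] J0[of y z] that by (auto simp: J_def)
    next
      case 2
      then show ?thesis using split[of x y z] that by simp
    next
      case 3
      then show ?thesis using split[of z y x] that sym by (simp add: max.commute)
    next
      case 4
      then show ?thesis using split[of y x z] that by simp
    next
      case 5
      then show ?thesis using split[of y z x] that sym by (simp add: le_max_iff_disj)
    next
      case 6
      then show ?thesis using split[of x z y] that by simp
    next
      case 7
      then show ?thesis using split[of z x y] that sym by (simp add: le_max_iff_disj)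
    qed
  qed
  have lip: "hausdorff_dist d (F s) (F t) \<le> K * J s t powr \<alpha>" if st: "s \<in> {a..b}" "t \<in> {a..b}" for s t
  proof -
    have "\<bar>g t - g s\<bar> \<le> J s t / kappa a b g" using J_ge[OF st] \<kappa> by (simp add: field_simps)
    then have "\<bar>g t - g s\<bar> powr \<alpha> \<le> (J s t / kappa a b g) powr \<alpha>"
      using \<open>0 < \<alpha>\<close> by (intro powr_mono2) auto
    also have "\<dots> = kappa a b g powr (-\<alpha>) * J s t powr \<alpha>"
      using J0[OF st] \<kappa> by (simp add: powr_divide powr_minus field_simps)
    finally have "L * \<bar>g t - g s\<bar> powr \<alpha> \<le> K * J s t powr \<alpha>"
      using \<open>0 \<le> L\<close> unfolding K_def mult.assoc by (rule mult_left_mono)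
    then show ?thesis using L st unfolding g_holder_bound_def by (meson order_trans)
  qed
  have J_powr_le: "J s t powr \<alpha> \<le> \<bar>g t - g s\<bar> powr \<alpha>" if "s \<in> {a..b}" "t \<in> {a..b}" for s t
    using J_le[OF that] J0[OF that] \<open>0 < \<alpha>\<close> by (intro powr_mono2) auto
  obtain f where f: "\<And>t. t \<in> {a..b} \<Longrightarrow> f t \<in> F t" "f \<theta> = x\<^sub>\<theta>"
    "\<And>s t. s \<in> {a..b} \<Longrightarrow> t \<in> {a..b} \<Longrightarrow> d (f s) (f t) \<le> 8 * K * J s t powr \<alpha>"
  proof (rule ultrametric_lipschitz_selection[of "{a..b}" "\<lambda>s t. J s t powr \<alpha>" "(g b - g a) powr \<alpha>" K F \<theta> x\<^sub>\<theta>])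
    fix x y z assume x: "x \<in> {a..b}" and y: "y \<in> {a..b}"
    show "J x y powr \<alpha> = J y x powr \<alpha>" by (simp add: J_def)
    show "J x x powr \<alpha> = 0" by (simp add: J_def)
    have "\<bar>g y - g x\<bar> \<le> g b - g a"
      using x y mono_onD[OF mono, of a x] mono_onD[OF mono, of x b]
        mono_onD[OF mono, of a y] mono_onD[OF mono, of y b] by auto
    then have "\<bar>g y - g x\<bar> powr \<alpha> \<le> (g b - g a) powr \<alpha>" using \<open>0 < \<alpha>\<close> by (intro powr_mono2) auto
    then show "J x y powr \<alpha> \<le> (g b - g a) powr \<alpha>" using J_powr_le[OF x y] by linarith
    assume z: "z \<in> {a..b}"
    have "J x z powr \<alpha> \<le> max (J x y) (J y z) powr \<alpha>"
      using J_ultra[OF x y z] J0[OF x z] \<open>0 < \<alpha>\<close> by (intro powr_mono2) auto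
    then show "J x z powr \<alpha> \<le> max (J x y powr \<alpha>) (J y z powr \<alpha>)"
      using J0[OF x y] J0[OF y z] \<open>0 < \<alpha>\<close> by (simp add: powr_max_distrib)
  qed (use F lip \<theta> \<open>0 \<le> K\<close> in auto)
  have bound: "g_holder_bound d {a..b} g \<alpha> f (8 * K)"
    unfolding g_holder_bound_def
  proof (intro conjI ballI)
    fix s t assume st: "s \<in> {a..b}" "t \<in> {a..b}"
    have "8 * K * J s t powr \<alpha> \<le> 8 * K * \<bar>g t - g s\<bar> powr \<alpha>"
      using J_powr_le[OF st] \<open>0 \<le> K\<close> by (intro mult_left_mono) auto
    then show "d (f s) (f t) \<le> 8 * K * \<bar>g t - g s\<bar> powr \<alpha>" using f(3)[OF st] by linarith
  qed (use \<open>0 \<le> K\<close> in simp)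
  have "g_holder_seminorm d {a..b} g \<alpha> f \<le> 8 * kappa a b g powr (-\<alpha>) * L"
    using g_holder_seminorm_le[OF bound] by (simp add: K_def mult_ac)
  then show "\<exists>f. selection_of {a..b} F f \<and> f \<theta> = x\<^sub>\<theta> \<and> g_holder d {a..b} g \<alpha> f \<and>
      g_holder_seminorm d {a..b} g \<alpha> f
        \<le> 8 * kappa a b g powr (-\<alpha>) * g_holder_seminorm (hausdorff_dist d) {a..b} g \<alpha> F"
    using f bound unfolding selection_of_def g_holder_def L_def by blast
qed

lemma pointed_holder_selections_imp_holder_selections:
  assumes "pointed_holder_selections TYPE('x) {a..b} g \<alpha> C" and "a \<le> b"
  shows "holder_selections TYPE('x) {a..b} g \<alpha>"
  unfolding holder_selections_def
proof (intro allI impI)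
  fix M :: "'x set" and d F
  assume MF: "Metric_space M d" "set_valued_holder_map M d {a..b} g \<alpha> F"
  have "a \<in> {a..b}" using assms by simp
  moreover from this have "F a \<noteq> {}"
    using MF(2) by (auto simp: set_valued_holder_map_def compact_subsets_def)
  ultimately show "\<exists>f. selection_of {a..b} F f \<and> g_holder d {a..b} g \<alpha> f"
    using assms(1) MF unfolding pointed_holder_selections_def by blast
qed

subsection \<open>Rotating points on a circle\<close>

lemma norm_cis_diff_le: "norm (cis x - cis y) \<le> \<bar>x - y\<bar>"
proof -
  have "norm (cis x - cis y) = norm (cis y * (cis (x - y) - 1))"
    by (simp add: cis_mult right_diff_distrib)
  also have "\<dots> = 2 * \<bar>sin ((x - y) / 2)\<bar>"
    using dist_exp_i_1[of "x - y"] by (simp add: norm_mult cis_conv_exp)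
  also have "\<dots> \<le> \<bar>x - y\<bar>" using abs_sin_x_le_abs_x[of "(x - y) / 2"] by simp
  finally show ?thesis .
qed

text \<open>The finitely many roots other than 1 keep a distance from 1. Division by w', a root of
  modulus 1, moves any pair to this situation.\<close>

lemma roots_of_unity_separated:
  assumes "0 < n"
  obtains c :: real where "0 < c"
    "\<And>w w' :: complex. w ^ n = 1 \<Longrightarrow> w' ^ n = 1 \<Longrightarrow> norm (w - w') < c \<Longrightarrow> w = w'"
proof -
  have "finite {w :: complex. w ^ n = 1}" using assms by (intro finite_roots_unity) simp
  then obtain c where c: "0 < c" "\<And>w :: complex. w ^ n = 1 \<Longrightarrow> w \<noteq> 1 \<Longrightarrow> c \<le> dist 1 w"
    using finite_set_avoid[of "{w :: complex. w ^ n = 1}" 1] by auto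
  have "w = w'" if w: "w ^ n = 1" "w' ^ n = 1" "norm (w - w') < c" for w w' :: complex
  proof (rule ccontr)
    assume "w \<noteq> w'"
    have "norm w' = 1" using power_eq_1_iff[OF w(2)] assms by simp
    then have "w' \<noteq> 0" by auto
    then have "c \<le> dist 1 (w / w')" using w \<open>w \<noteq> w'\<close> by (intro c) (auto simp: power_divide)
    also have "\<dots> = norm (w - w') / norm w'"
      using \<open>w' \<noteq> 0\<close> by (simp add: dist_norm norm_divide[symmetric] diff_divide_distrib norm_minus_commute)
    finally show False using w \<open>norm w' = 1\<close> by simp
  qed
  with c show thesis by (intro that) auto
qed

text \<open>As \<open>u\<close> moves by \<open>G / m\<close>, these \<open>2 * m\<close> equidistant points rotate by one spacing: the set is
  unchanged, while each point has moved.  A branch has reached the antipode when \<open>u\<close> has moved by \<open>G\<close>.\<close>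

definition rotating_points :: "nat \<Rightarrow> real \<Rightarrow> real \<Rightarrow> real \<Rightarrow> complex set" where
  "rotating_points m G r u = {of_real r * (w * cis (pi * u / G)) | w. w ^ (2 * m) = 1}"

lemma finite_rotating_points: "0 < m \<Longrightarrow> finite (rotating_points m G r u)"
  using finite_roots_unity[of "2 * m"] unfolding rotating_points_def by (intro finite_image_set) simp

lemma rotating_points_nonempty: "rotating_points m G r u \<noteq> {}"
  unfolding rotating_points_def by (auto intro: exI[of _ 1])

lemma norm_rotating_points:
  assumes "z \<in> rotating_points m G r u" "0 < m" "0 \<le> r"
  shows "norm z = r"
  using assms by (auto simp: rotating_points_def norm_mult dest!: power_eq_1_iff)

text \<open>The radius is normalised so that one spacing, an arc of length
  \<open>r * pi / m\<close>, equals \<open>(G / m) powr \<alpha>\<close>. In units of h = G / m the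
  claim becomes that q is within \<open>\<bar>q\<bar> powr \<alpha>\<close> of a suitable
  integer.\<close>

lemma rotating_points_holder:
  assumes "0 < m" "0 < G" "0 < \<alpha>" "\<alpha> < 1"
    and z: "z \<in> rotating_points m G (real m powr (1 - \<alpha>) / pi * G powr \<alpha>) u"
  shows "\<exists>z'\<in>rotating_points m G (real m powr (1 - \<alpha>) / pi * G powr \<alpha>) v. dist z z' \<le> \<bar>u - v\<bar> powr \<alpha>"
proof -
  define r where "r = real m powr (1 - \<alpha>) / pi * G powr \<alpha>"
  define h where "h = G / m"
  define q where "q = (u - v) / h"
  \<comment> \<open>Short moves follow the branch, where \<bar>q\<bar> is at most its power; longer
    ones jump by j spacings to a point within one spacing, where the power is at least 1.\<close>
  define j :: int where "j = (if \<bar>q\<bar> \<le> 1 then 0 else \<lfloor>q\<rfloor>)"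
  have "0 < h" using assms by (simp add: h_def)
  have "0 \<le> r" by (simp add: r_def)
  obtain w where w: "w ^ (2 * m) = 1" "z = of_real r * (w * cis (pi * u / G))"
    using z by (auto simp: rotating_points_def r_def)
  define z' where "z' = of_real r * (w * cis (pi * j / m) * cis (pi * v / G))"
  have "cis (pi * j / m) ^ (2 * m) = 1"
  proof -
    have "cis (pi * j / m) ^ (2 * m) = cis (real (2 * m) * (pi * j / m))" by (rule Complex.DeMoivre)
    also have "real (2 * m) * (pi * j / m) = 2 * pi * j" using assms by simp
    also have "cis (2 * pi * j) = 1" by simp
    finally show ?thesis .
  qed
  then have z': "z' \<in> rotating_points m G r v"
    unfolding rotating_points_def z'_def using w
    by (intro CollectI exI[of _ "w * cis (pi * j / m)"]) (simp add: power_mult_distrib)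
  have "dist z z' = r * norm (cis (pi * u / G) - cis (pi * j / m + pi * v / G))"
  proof -
    have "z - z' = of_real r * w * (cis (pi * u / G) - cis (pi * j / m + pi * v / G))"
      by (simp add: w z'_def cis_mult[symmetric] algebra_simps)
    then show ?thesis using power_eq_1_iff[OF w(1)] assms \<open>0 \<le> r\<close> by (simp add: dist_norm norm_mult)
  qed
  also have "\<dots> \<le> r * \<bar>pi * u / G - (pi * j / m + pi * v / G)\<bar>"
    using norm_cis_diff_le \<open>0 \<le> r\<close> by (intro mult_left_mono)
  also have "pi * u / G - (pi * j / m + pi * v / G) = pi / m * (q - j)"
    using assms by (simp add: q_def h_def field_simps)
  also have "r * \<bar>pi / m * (q - j)\<bar> = h powr \<alpha> * \<bar>q - j\<bar>"
    unfolding abs_mult[of "pi / m"] using assms by (simp add: r_def h_def powr_diff powr_divide)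
  also have "\<bar>q - j\<bar> \<le> \<bar>q\<bar> powr \<alpha>"
  proof (cases "\<bar>q\<bar> \<le> 1")
    case True
    have "\<bar>q\<bar> powr 1 \<le> \<bar>q\<bar> powr \<alpha>" using True assms by (intro powr_mono') auto
    then show ?thesis using True by (simp add: j_def)
  next
    case False
    have "\<bar>q - j\<bar> \<le> 1" using False by (simp add: j_def) linarith
    also have "1 \<le> \<bar>q\<bar> powr \<alpha>" using False assms by (intro ge_one_powr_ge_zero) auto
    finally show ?thesis .
  qed
  also have "h powr \<alpha> * \<bar>q\<bar> powr \<alpha> = \<bar>u - v\<bar> powr \<alpha>"
    using \<open>0 < h\<close> by (simp add: q_def powr_mult[symmetric] abs_divide)
  finally have "dist z z' \<le> \<bar>u - v\<bar> powr \<alpha>" by (simp add: mult_left_mono)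
  then show ?thesis using z' unfolding r_def by blast
qed

text \<open>The label \<omega> x is the root of unity left after undoing the rotation at g x. Where
  g varies little, labels differ by less than the separation c, so they agree; hence the label is
  the same at s and t. Over the increment G the rotation is by pi, which sends \<phi> s to its
  antipode.\<close>

lemma rotating_points_obstruction:
  fixes g :: "real \<Rightarrow> real"
  assumes mono: "mono_on {a..b} g"
    and left: "\<And>t. t \<in> {a<..b} \<Longrightarrow> continuous (at_left t) g"
    and st: "a \<le> s" "s < t" "t \<le> b"
    and G: "G = g t - g s" "0 < G" and "0 < m" "0 < r" "0 < \<alpha>" "0 < \<epsilon>" "0 \<le> A"
    and jump: "\<And>\<tau>. \<tau> \<in> {s..<t} \<Longrightarrow> right_jump g \<tau> < \<epsilon> * G"
    and sep: "\<And>w w' :: complex. w ^ (2 * m) = 1 \<Longrightarrow> w' ^ (2 * m) = 1 \<Longrightarrow> norm (w - w') < c \<Longrightarrow> w = w'"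
    and small: "A * (\<epsilon> * G) powr \<alpha> + r * (pi * \<epsilon>) < c * r"
    and \<phi>: "\<And>x. x \<in> {a..b} \<Longrightarrow> \<phi> x \<in> rotating_points m G r (g x)"
    and holder: "\<And>x y. x \<in> {a..b} \<Longrightarrow> y \<in> {a..b} \<Longrightarrow> dist (\<phi> x) (\<phi> y) \<le> A * \<bar>g y - g x\<bar> powr \<alpha>"
  shows "2 * r \<le> A * G powr \<alpha>"
proof -
  obtain \<omega> where \<omega>: "\<omega> x ^ (2 * m) = 1" "\<phi> x = of_real r * (\<omega> x * cis (pi * g x / G))"
    if "x \<in> {a..b}" for x
    using \<phi> unfolding rotating_points_def mem_Collect_eq by metis
  have step: "\<omega> x = \<omega> y" if x: "x \<in> {s..t}" and y: "y \<in> {s..t}" and xy: "\<bar>g x - g y\<bar> < \<epsilon> * G" for x y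
  proof (rule sep)
    have xI: "x \<in> {a..b}" and yI: "y \<in> {a..b}" using x y st by auto
    show "\<omega> x ^ (2 * m) = 1" "\<omega> y ^ (2 * m) = 1" using \<omega> xI yI by auto
    have ny: "norm (\<omega> y) = 1" using power_eq_1_iff[OF \<omega>(1)[OF yI]] \<open>0 < m\<close> by simp
    \<comment> \<open>Both points are compared in the frame rotated by g x; the second summand below
      is the error from using that frame at y.\<close>
    have "r * norm (\<omega> x - \<omega> y) = norm (of_real r * (\<omega> x - \<omega> y) * cis (pi * g x / G))"
      using \<open>0 < r\<close> by (simp add: norm_mult)
    also have "of_real r * (\<omega> x - \<omega> y) * cis (pi * g x / G)
        = (\<phi> x - \<phi> y) + of_real r * (\<omega> y * (cis (pi * g y / G) - cis (pi * g x / G)))"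
      by (simp add: \<omega>(2)[OF xI] \<omega>(2)[OF yI] algebra_simps)
    also have "norm \<dots> \<le> dist (\<phi> x) (\<phi> y) + r * norm (cis (pi * g y / G) - cis (pi * g x / G))"
      using \<open>0 < r\<close> ny by (intro order_trans[OF norm_triangle_ineq]) (simp add: norm_mult dist_norm)
    also have "dist (\<phi> x) (\<phi> y) \<le> A * (\<epsilon> * G) powr \<alpha>"
    proof -
      have "\<bar>g y - g x\<bar> powr \<alpha> \<le> (\<epsilon> * G) powr \<alpha>"
        using xy \<open>0 < \<alpha>\<close> by (intro powr_mono2) auto
      then show ?thesis using holder[OF xI yI] mult_left_mono[OF _ \<open>0 \<le> A\<close>] by (meson order_trans)
    qed
    also have "norm (cis (pi * g y / G) - cis (pi * g x / G)) \<le> pi * \<epsilon>"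
    proof -
      have "\<bar>pi * g y / G - pi * g x / G\<bar> = pi / G * \<bar>g x - g y\<bar>"
        using \<open>0 < G\<close> by (simp add: diff_divide_distrib[symmetric] right_diff_distrib[symmetric] abs_mult abs_minus_commute)
      also have "\<dots> \<le> pi / G * (\<epsilon> * G)" using xy \<open>0 < G\<close> by (intro mult_left_mono) auto
      finally show ?thesis using norm_cis_diff_le[of "pi * g y / G" "pi * g x / G"] \<open>0 < G\<close> by simp
    qed
    finally have "r * norm (\<omega> x - \<omega> y) \<le> A * (\<epsilon> * G) powr \<alpha> + r * (pi * \<epsilon>)"
      using \<open>0 < r\<close> by (simp add: mult_left_mono)
    also have "\<dots> < r * c" using small by (simp add: mult.commute)
    finally show "norm (\<omega> x - \<omega> y) < c" using \<open>0 < r\<close> by simp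
  qed
  have "\<omega> s = \<omega> t"
  proof (rule small_jumps_induct[OF mono left, where R = "\<lambda>x y. \<omega> x = \<omega> y" and \<eta> = "\<epsilon> * G"])
    show "s \<le> t" using st by simp
    show "0 < \<epsilon> * G" using \<open>0 < \<epsilon>\<close> \<open>0 < G\<close> by simp
  qed (fact st jump step | assumption | metis)+
  moreover have sI: "s \<in> {a..b}" "t \<in> {a..b}" using st by auto
  moreover have "g t = G + g s" using G by simp
  then have "pi * g t / G = pi * g s / G + pi" using G(2) by (simp add: field_simps)
  ultimately have "\<phi> t = - \<phi> s" by (simp add: \<omega>(2) cis_mult[symmetric])
  then have "dist (\<phi> s) (\<phi> t) = 2 * norm (\<phi> s)" by (simp add: dist_norm flip: mult_2)
  also have "\<dots> = 2 * r" using norm_rotating_points[OF \<phi>[OF sI(1)]] \<open>0 < m\<close> \<open>0 < r\<close> by simp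
  finally show ?thesis using holder[OF sI] G by simp
qed

text \<open>The choices are made in the order m, c, \<epsilon>, D, interval: m makes \<rho> exceed
  A, c depends on m, and only then is the interval taken. The sets are indexed by values of g. The
  norm bound keeps all distances at most 1, below the truncation in the product metric.\<close>

lemma circle_obstruction:
  fixes g :: "real \<Rightarrow> real"
  assumes \<alpha>: "0 < \<alpha>" "\<alpha> < 1" and "a < b" and nconst: "\<not> g constant_on {a..b}"
    and left: "\<And>t. t \<in> {a<..b} \<Longrightarrow> continuous (at_left t) g"
    and mono: "mono_on {a..b} g"
    and \<kappa>: "\<not> 0 < kappa a b g" and "0 \<le> A"
  shows "\<exists>Z :: real \<Rightarrow> complex set. (\<forall>u. finite (Z u) \<and> Z u \<noteq> {}) \<and>
    (\<forall>u v. \<forall>z\<in>Z u. \<exists>z'\<in>Z v. dist z z' \<le> \<bar>u - v\<bar> powr \<alpha>) \<and>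
    (\<forall>u. \<forall>z\<in>Z u. norm z \<le> 1 / 2) \<and>
    \<not> (\<exists>\<phi>. (\<forall>t\<in>{a..b}. \<phi> t \<in> Z (g t)) \<and>
          (\<forall>s\<in>{a..b}. \<forall>t\<in>{a..b}. dist (\<phi> s) (\<phi> t) \<le> A * \<bar>g t - g s\<bar> powr \<alpha>))"
proof -
  obtain m :: nat where "(A * pi + 1) powr (1 / (1 - \<alpha>)) < real m"
    using reals_Archimedean2 by blast
  then have "((A * pi + 1) powr (1 / (1 - \<alpha>))) powr (1 - \<alpha>) \<le> real m powr (1 - \<alpha>)" "0 < real m"
    using \<alpha> by (auto intro!: powr_mono2 simp del: of_nat_0_less_iff intro: le_less_trans[OF powr_ge_zero])
  then have m: "A * pi < real m powr (1 - \<alpha>)" "0 < m"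
    using \<alpha> \<open>0 \<le> A\<close> by (auto simp: powr_powr)
  define \<rho> where "\<rho> = real m powr (1 - \<alpha>) / pi"
  have \<rho>: "0 < \<rho>" "A < \<rho>" using m by (auto simp: \<rho>_def field_simps)
  obtain c where c: "0 < c"
    "\<And>w w' :: complex. w ^ (2 * m) = 1 \<Longrightarrow> w' ^ (2 * m) = 1 \<Longrightarrow> norm (w - w') < c \<Longrightarrow> w = w'"
    using roots_of_unity_separated[of "2 * m"] m by auto
  \<comment> \<open>The smallness condition of the obstruction, divided by
    \<open>G powr \<alpha>\<close>: in this form \<epsilon> can be fixed before G is known.\<close>
  have "((\<lambda>\<epsilon>. A * \<epsilon> powr \<alpha> + \<rho> * (pi * \<epsilon>)) \<longlongrightarrow> A * 0 powr \<alpha> + \<rho> * (pi * 0)) (at_right 0)"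
    using \<alpha> by (intro tendsto_intros tendsto_powr') (auto intro!: eventually_mono[OF eventually_at_right_less])
  then have "\<forall>\<^sub>F \<epsilon> in at_right 0. A * \<epsilon> powr \<alpha> + \<rho> * (pi * \<epsilon>) < c * \<rho>"
    by (rule order_tendstoD) (use \<rho> c in simp)
  then have "\<forall>\<^sub>F \<epsilon> in at_right 0. A * \<epsilon> powr \<alpha> + \<rho> * (pi * \<epsilon>) < c * \<rho> \<and> 0 < \<epsilon>"
    using eventually_at_right_less by (rule eventually_conj)
  then obtain \<epsilon> :: real where \<epsilon>: "A * \<epsilon> powr \<alpha> + \<rho> * (pi * \<epsilon>) < c * \<rho>" "0 < \<epsilon>"
    using eventually_happens' trivial_limit_at_right_real by blast
  \<comment> \<open>Increments up to D give r at most 1/2.\<close>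
  define D where "D = (1 / (2 * \<rho>)) powr (1 / \<alpha>)"
  have "0 < D" using \<rho> by (simp add: D_def)
  obtain s t where st: "a \<le> s" "s < t" "t \<le> b" "0 < g t - g s" "g t - g s \<le> D"
    "\<And>\<tau>. \<tau> \<in> {s..<t} \<Longrightarrow> right_jump g \<tau> < \<epsilon> * (g t - g s)"
    using small_jump_interval[OF \<open>a < b\<close> nconst left mono \<kappa> \<epsilon>(2) \<open>0 < D\<close>] by blast
  define G where "G = g t - g s"
  define r where "r = \<rho> * G powr \<alpha>"
  have "0 < G" using st by (simp add: G_def)
  have "0 < r" using \<rho> \<open>0 < G\<close> by (simp add: r_def)
  have "G powr \<alpha> \<le> D powr \<alpha>" using st \<alpha> by (intro powr_mono2) (auto simp: G_def)
  also have "\<dots> = 1 / (2 * \<rho>)" using \<rho> \<alpha> by (simp add: D_def powr_powr)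
  finally have "r \<le> 1 / 2" using \<rho> by (simp add: r_def field_simps)
  have small: "A * (\<epsilon> * G) powr \<alpha> + r * (pi * \<epsilon>) < c * r"
  proof -
    have "A * (\<epsilon> * G) powr \<alpha> + r * (pi * \<epsilon>) = (A * \<epsilon> powr \<alpha> + \<rho> * (pi * \<epsilon>)) * G powr \<alpha>"
      using \<epsilon> \<open>0 < G\<close> by (simp add: powr_mult r_def algebra_simps)
    also have "\<dots> < c * \<rho> * G powr \<alpha>"
      using \<epsilon> \<open>0 < G\<close> by (intro mult_strict_right_mono) auto
    finally show ?thesis by (simp add: r_def)
  qed
  have big: "A * G powr \<alpha> < 2 * r"
  proof -
    have "A * G powr \<alpha> < \<rho> * G powr \<alpha>" using \<rho> \<open>0 < G\<close> by (intro mult_strict_right_mono) auto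
    then show ?thesis using \<open>0 < r\<close> by (simp add: r_def)
  qed
  have no: False if "\<And>x. x \<in> {a..b} \<Longrightarrow> \<phi> x \<in> rotating_points m G r (g x)"
    "\<And>x y. x \<in> {a..b} \<Longrightarrow> y \<in> {a..b} \<Longrightarrow> dist (\<phi> x) (\<phi> y) \<le> A * \<bar>g y - g x\<bar> powr \<alpha>" for \<phi>
    using rotating_points_obstruction[OF mono left st(1-3) G_def \<open>0 < G\<close> m(2) \<open>0 < r\<close> \<alpha>(1) \<epsilon>(2) \<open>0 \<le> A\<close>
        st(6)[folded G_def] c(2) small that] big by linarith
  show ?thesis
  proof (intro exI[of _ "rotating_points m G r"] conjI allI ballI notI)
    show "\<exists>z'\<in>rotating_points m G r v. dist z z' \<le> \<bar>u - v\<bar> powr \<alpha>"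
      if "z \<in> rotating_points m G r u" for u v z
      using rotating_points_holder[OF m(2) \<open>0 < G\<close> \<alpha>, of z u v] that by (simp add: r_def \<rho>_def)
    show "norm z \<le> 1 / 2" if "z \<in> rotating_points m G r u" for z u
      using norm_rotating_points[OF that] m \<open>0 < r\<close> \<open>r \<le> 1 / 2\<close> by simp
  next
    assume "\<exists>\<phi>. (\<forall>t\<in>{a..b}. \<phi> t \<in> rotating_points m G r (g t)) \<and>
          (\<forall>s\<in>{a..b}. \<forall>t\<in>{a..b}. dist (\<phi> s) (\<phi> t) \<le> A * \<bar>g t - g s\<bar> powr \<alpha>)"
    then show False using no by blast
  qed (use m finite_rotating_points rotating_points_nonempty in auto)
qed

subsection \<open>A product of circles\<close>

text \<open>The metric is pushed forward along an injection. This carries the counterexample, built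
  on one concrete type, into every type that is at least as large.\<close>

lemma holder_selections_transfer:
  assumes sel: "holder_selections TYPE('u) I g \<alpha>" and le: "(UNIV :: 'y set) \<lesssim> (UNIV :: 'u set)"
  shows "holder_selections TYPE('y) I g \<alpha>"
  unfolding holder_selections_def
proof (intro allI impI)
  fix M :: "'y set" and d F
  assume "Metric_space M d" and F: "set_valued_holder_map M d I g \<alpha> F"
  then interpret Metric_space M d by simp
  obtain i :: "'y \<Rightarrow> 'u" where i: "inj i" using le unfolding lepoll_def by auto
  define d' where "d' x y = d (inv i x) (inv i y)" for x y
  have d'_i: "d' (i x) (i y) = d x y" for x y using i by (simp add: d'_def)
  interpret M': Metric_space "i ` M" d'
    by unfold_locales (auto simp: d'_i zero triangle, simp_all add: d'_def commute)
  have "i ` A \<in> compact_subsets (i ` M) d'" if A: "A \<in> compact_subsets M d" for A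
  proof -
    have "\<exists>l r. l \<in> i ` A \<and> strict_mono r \<and> limitin M'.mtopology (\<sigma> \<circ> r) l sequentially"
      if "range \<sigma> \<subseteq> i ` A" for \<sigma> :: "nat \<Rightarrow> 'u"
    proof -
      have "\<forall>n. \<exists>y. y \<in> A \<and> \<sigma> n = i y" using that by blast
      then obtain \<tau> where \<tau>: "\<And>n. \<tau> n \<in> A" "\<And>n. \<sigma> n = i (\<tau> n)" by metis
      then obtain l r where l: "l \<in> A" "strict_mono r" "limitin mtopology (\<tau> \<circ> r) l sequentially"
        using A unfolding compact_subsets_def compactin_sequentially by blast
      then have "limitin M'.mtopology (\<sigma> \<circ> r) (i l) sequentially"
        by (simp add: limitin_metric_dist_null M'.limitin_metric_dist_null \<tau> d'_i inj_image_mem_iff[OF i])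
      with l show ?thesis by blast
    qed
    then show ?thesis
      using A compact_subsets_subset[OF A] unfolding compact_subsets_def M'.compactin_sequentially by blast
  qed
  moreover have "dist_to_set d' (i x) (i ` A) = dist_to_set d x A" for x A
    by (simp add: dist_to_set_def image_image d'_i)
  then have "hausdorff_dist d' (i ` A) (i ` B) = hausdorff_dist d A B" for A B
    by (simp add: hausdorff_dist_def image_image)
  ultimately have "set_valued_holder_map (i ` M) d' I g \<alpha> (\<lambda>t. i ` F t)"
    using F by (auto simp: set_valued_holder_map_def g_holder_def g_holder_bound_def)
  then obtain f where f: "selection_of I (\<lambda>t. i ` F t) f" "g_holder d' I g \<alpha> f"
    using sel M'.Metric_space_axioms unfolding holder_selections_def by blast
  have "selection_of I F (\<lambda>t. inv i (f t))"
    using f(1) i unfolding selection_of_def by (metis imageE inv_f_f)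
  moreover have "g_holder d I g \<alpha> (\<lambda>t. inv i (f t))"
    using f(2) by (simp add: g_holder_def g_holder_bound_def d'_def)
  ultimately show "\<exists>f. selection_of I F f \<and> g_holder d I g \<alpha> f" by blast
qed

text \<open>A point of a T0 space is determined by the basic open sets around it; for a countable
  basis this codes points as sets of naturals.\<close>

lemma second_countable_t0_lepoll_reals:
  "(UNIV :: 'y :: {second_countable_topology, t0_space} set) \<lesssim> (UNIV :: real set)"
proof -
  obtain B :: "'y set set" where B: "countable B" "topological_basis B"
    using ex_countable_basis by blast
  obtain e :: "'y set \<Rightarrow> nat" where e: "inj_on e B" using B(1) by (auto simp: countable_def)
  have "inj (\<lambda>x. e ` {U \<in> B. x \<in> U})"
  proof (rule injI, rule ccontr)
    fix x y assume eq: "e ` {U \<in> B. x \<in> U} = e ` {U \<in> B. y \<in> U}" and "x \<noteq> y"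
    have "{U \<in> B. x \<in> U} = {U \<in> B. y \<in> U}"
      using eq by (subst (asm) inj_on_image_eq_iff[OF e]) auto
    moreover obtain W where W: "open W" "(x \<in> W) \<noteq> (y \<in> W)" using iffD1[OF separation_t0 \<open>x \<noteq> y\<close>] by blast
    then obtain z where z: "z \<in> {x, y}" "z \<in> W" by blast
    moreover obtain U where "U \<in> B" "z \<in> U" "U \<subseteq> W"
      using topological_basisE[OF B(2) W(1) z(2)] by blast
    ultimately show False using W by blast
  qed
  then have "(UNIV :: 'y set) \<lesssim> (UNIV :: nat set set)" unfolding lepoll_def by auto
  then show ?thesis using nat_sets_eqpoll_reals lepoll_trans2 by blast
qed

text \<open>The product metric is a series of truncated coordinate distances with weights
  \<open>(1/2)^n\<close>. One term bounds it below, and the geometric series of sum 2 bounds it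
  above.\<close>

lemma dist_fun_bounds:
  fixes x y :: "'i::countable \<Rightarrow> 'y::metric_space"
  shows dist_fun_ge_coordinate: "min (dist (x k) (y k)) 1 \<le> 2 ^ to_nat k * dist x y"
    and dist_fun_le: "(\<And>k. dist (x k) (y k) \<le> \<delta>) \<Longrightarrow> dist x y \<le> 2 * \<delta>"
proof -
  define s where "s n = (1/2)^n * min (dist (x (from_nat n)) (y (from_nat n))) 1" for n :: nat
  have s: "summable s" "0 \<le> s n" for n
    unfolding s_def by (rule summable_comparison_test'[of "\<lambda>n. (1/2)^n"]) (auto simp: summable_geometric_iff)
  have "s (to_nat k) \<le> dist x y"
    using sum_le_suminf[OF s(1), of "{to_nat k}"] s(2) by (simp add: dist_fun_def s_def[abs_def])
  then show "min (dist (x k) (y k)) 1 \<le> 2 ^ to_nat k * dist x y"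
    by (simp add: s_def power_one_over field_simps)
  show "dist x y \<le> 2 * \<delta>" if \<delta>: "\<And>k. dist (x k) (y k) \<le> \<delta>"
  proof -
    have "s n \<le> (1/2)^n * \<delta>" for n
      unfolding s_def using \<delta> by (intro mult_left_mono min.coboundedI1) auto
    then have "suminf s \<le> (\<Sum>n. (1/2)^n * \<delta>)"
      by (intro suminf_le s(1) summable_mult2) (auto simp: summable_geometric_iff)
    also have "\<dots> = 2 * \<delta>"
      using suminf_mult2[of "\<lambda>n. (1/2)^n" \<delta>] suminf_geometric[of "1/2 :: real"]
      by (simp add: summable_geometric_iff)
    finally show ?thesis by (simp add: dist_fun_def s_def[abs_def])
  qed
qed

lemma hausdorff_dist_le:
  assumes "\<And>x y. 0 \<le> d x y" "A \<noteq> {}" "B \<noteq> {}"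
    and "\<And>x. x \<in> A \<Longrightarrow> \<exists>y\<in>B. d x y \<le> \<delta>" "\<And>y. y \<in> B \<Longrightarrow> \<exists>x\<in>A. d y x \<le> \<delta>"
  shows "hausdorff_dist d A B \<le> \<delta>"
proof -
  have "dist_to_set d x C \<le> \<delta>" if near: "\<exists>y\<in>C. d x y \<le> \<delta>" for x C
  proof -
    obtain y where y: "y \<in> C" "d x y \<le> \<delta>" using near by blast
    then have "dist_to_set d x C \<le> d x y"
      unfolding dist_to_set_def using assms(1) by (intro cINF_lower bdd_belowI2[of _ 0]) auto
    then show ?thesis using y by simp
  qed
  then show ?thesis
    unfolding hausdorff_dist_def using assms(2-5) by (intro max.boundedI cSUP_least) blast+
qed

text \<open>A diagonal argument: the k-th factor excludes selections with constant k, after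
  correction for its weight in the product. A Hoelder selection of the product with constant L
  contradicts any factor with k at least L.\<close>

lemma holder_selections_imp_kappa_pos:
  fixes g :: "real \<Rightarrow> real"
  assumes \<alpha>: "0 < \<alpha>" "\<alpha> < 1" and "a < b" and nconst: "\<not> g constant_on {a..b}"
    and left: "\<And>t. t \<in> {a<..b} \<Longrightarrow> continuous (at_left t) g"
    and mono: "mono_on {a..b} g"
    and sel: "holder_selections TYPE(nat \<Rightarrow> complex) {a..b} g \<alpha>"
  shows "0 < kappa a b g"
proof (rule ccontr)
  assume \<kappa>: "\<not> 0 < kappa a b g"
  define P :: "nat \<Rightarrow> (real \<Rightarrow> complex set) \<Rightarrow> bool" where
    "P k Z \<longleftrightarrow> (\<forall>u. finite (Z u) \<and> Z u \<noteq> {}) \<and>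
      (\<forall>u v. \<forall>z\<in>Z u. \<exists>z'\<in>Z v. dist z z' \<le> \<bar>u - v\<bar> powr \<alpha>) \<and>
      (\<forall>u. \<forall>z\<in>Z u. norm z \<le> 1 / 2) \<and>
      \<not> (\<exists>\<phi>. (\<forall>t\<in>{a..b}. \<phi> t \<in> Z (g t)) \<and> (\<forall>s\<in>{a..b}. \<forall>t\<in>{a..b}.
          dist (\<phi> s) (\<phi> t) \<le> 2 ^ to_nat k * real k * \<bar>g t - g s\<bar> powr \<alpha>))" for k Z
  have "\<exists>Z. P k Z" for k
    unfolding P_def by (rule circle_obstruction[OF \<alpha> \<open>a < b\<close> nconst left mono \<kappa>]) auto
  then obtain Z where "\<And>k. P k (Z k)" by metis
  then have Z: "finite (Z k u)" "Z k u \<noteq> {}"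
      "z \<in> Z k u \<Longrightarrow> \<exists>z'\<in>Z k v. dist z z' \<le> \<bar>u - v\<bar> powr \<alpha>"
      "z \<in> Z k u \<Longrightarrow> norm z \<le> 1 / 2"
    and noZ: "\<lbrakk>\<And>t. t \<in> {a..b} \<Longrightarrow> \<phi> t \<in> Z k (g t);
      \<And>s t. s \<in> {a..b} \<Longrightarrow> t \<in> {a..b} \<Longrightarrow>
        dist (\<phi> s) (\<phi> t) \<le> 2 ^ to_nat k * real k * \<bar>g t - g s\<bar> powr \<alpha>\<rbrakk> \<Longrightarrow> False"
    for k u v z \<phi>
    unfolding P_def by blast+
  define F where "F t = (\<Pi>\<^sub>E k\<in>UNIV. Z k (g t))" for t
  have F_iff: "x \<in> F t \<longleftrightarrow> (\<forall>k. x k \<in> Z k (g t))" for x t by (simp add: F_def PiE_iff)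
  have Fne: "F t \<noteq> {}" for t using Z(2) by (simp add: F_def PiE_eq_empty_iff)
  \<comment> \<open>Tychonoff for finite factors.\<close>
  have "compactin euclidean (F t)" for t
    unfolding F_def euclidean_product_topology[symmetric]
    by (subst compactin_PiE) (use Z(1) in \<open>simp add: finite_imp_compact\<close>)
  then have comp: "F t \<in> compact_subsets UNIV dist" for t
    using Fne by (simp add: compact_subsets_def)
  have near: "\<exists>y\<in>F t. dist x y \<le> 2 * \<bar>g t - g s\<bar> powr \<alpha>" if "x \<in> F s" for x s t
  proof -
    have "\<forall>k. \<exists>z. z \<in> Z k (g t) \<and> dist (x k) z \<le> \<bar>g s - g t\<bar> powr \<alpha>"
      using that Z(3) unfolding F_iff by blast
    then obtain y where "\<And>k. y k \<in> Z k (g t)" "\<And>k. dist (x k) (y k) \<le> \<bar>g s - g t\<bar> powr \<alpha>" by metis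
    then show ?thesis
      using dist_fun_le[of x y] by (intro bexI[of _ y]) (auto simp: F_iff abs_minus_commute)
  qed
  have "hausdorff_dist dist (F s) (F t) \<le> 2 * \<bar>g t - g s\<bar> powr \<alpha>" for s t
    using near[of _ s t] near[of _ t s] Fne by (intro hausdorff_dist_le) (auto simp: abs_minus_commute)
  then have "g_holder (hausdorff_dist dist) {a..b} g \<alpha> F"
    unfolding g_holder_def g_holder_bound_def by (intro exI[of _ 2]) auto
  then have "set_valued_holder_map UNIV dist {a..b} g \<alpha> F"
    using comp by (simp add: set_valued_holder_map_def)
  then obtain f where f: "selection_of {a..b} F f" "g_holder dist {a..b} g \<alpha> f"
    using sel Met_TC.Metric_space_axioms unfolding holder_selections_def by blast
  then obtain L where L: "\<And>s t. s \<in> {a..b} \<Longrightarrow> t \<in> {a..b} \<Longrightarrow>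
      dist (f s) (f t) \<le> L * \<bar>g t - g s\<bar> powr \<alpha>"
    unfolding g_holder_def g_holder_bound_def by blast
  obtain k :: nat where k: "L \<le> real k" using real_arch_simple by blast
  show False
  proof (rule noZ[of "\<lambda>t. f t k" k])
    show Zk: "f t k \<in> Z k (g t)" if "t \<in> {a..b}" for t
      using f(1) that by (auto simp: selection_of_def F_iff)
    fix s t assume st: "s \<in> {a..b}" "t \<in> {a..b}"
    \<comment> \<open>All points of the factor have norm at most 1/2, so the truncation at 1 in the
      product metric has no effect.\<close>
    have "dist (f s k) (f t k) \<le> 1"
      using norm_triangle_ineq4[of "f s k" "f t k"] Z(4)[OF Zk[OF st(1)]] Z(4)[OF Zk[OF st(2)]]
      by (simp add: dist_norm)
    then have "dist (f s k) (f t k) \<le> 2 ^ to_nat k * dist (f s) (f t)"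
      using dist_fun_ge_coordinate[of "f s" k "f t"] by simp
    also have "dist (f s) (f t) \<le> real k * \<bar>g t - g s\<bar> powr \<alpha>"
      using L[OF st] mult_right_mono[OF k, of "\<bar>g t - g s\<bar> powr \<alpha>"] by simp
    finally show "dist (f s k) (f t k) \<le> 2 ^ to_nat k * real k * \<bar>g t - g s\<bar> powr \<alpha>"
      by (simp add: mult.assoc mult_left_mono)
  qed
qed

section \<open>The equivalences and the explicit constant\<close>

theorem theorem5p4:
  fixes \<alpha> a b :: real and g :: "real \<Rightarrow> real"
  assumes "0 < \<alpha>" and "\<alpha> < 1" and "a < b"
    and "\<not> g constant_on {a..b}"
    and "\<And>t. t \<in> {a<..b} \<Longrightarrow> continuous (at_left t) g"
    and "mono_on {a..b} g"
    and "(UNIV :: real set) \<lesssim> (UNIV :: 'u set)"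
  shows "(0 < kappa a b g \<longleftrightarrow> holder_selections TYPE('u) {a..b} g \<alpha>) \<and>
    (0 < kappa a b g \<longleftrightarrow> (\<exists>C. pointed_holder_selections TYPE('u) {a..b} g \<alpha> C)) \<and>
    (0 < kappa a b g \<longrightarrow>
       holder_selections TYPE('x) {a..b} g \<alpha> \<and>
       pointed_holder_selections TYPE('x) {a..b} g \<alpha> (8 * kappa a b g powr (-\<alpha>)))"
proof -
  \<comment> \<open>The counterexample lives in \<open>nat \<Rightarrow> complex\<close>, which
    injects into the reals and hence into \<open>'u\<close>.\<close>
  have "(UNIV :: (nat \<Rightarrow> complex) set) \<lesssim> (UNIV :: 'u set)"
    using second_countable_t0_lepoll_reals assms(7) by (rule lepoll_trans)
  then have "0 < kappa a b g" if "holder_selections TYPE('u) {a..b} g \<alpha>"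
    using holder_selections_imp_kappa_pos[OF assms(1-6)] holder_selections_transfer[OF that] by blast
  moreover have "pointed_holder_selections TYPE('u) {a..b} g \<alpha> (8 * kappa a b g powr (-\<alpha>))"
    and "pointed_holder_selections TYPE('x) {a..b} g \<alpha> (8 * kappa a b g powr (-\<alpha>))"
    if "0 < kappa a b g"
    using kappa_pos_imp_pointed_holder_selections[OF assms(1,6) that] by simp_all
  moreover have "holder_selections TYPE('u) {a..b} g \<alpha>"
    if "pointed_holder_selections TYPE('u) {a..b} g \<alpha> C" for C
    using pointed_holder_selections_imp_holder_selections[OF that] \<open>a < b\<close> by simp
  moreover have "holder_selections TYPE('x) {a..b} g \<alpha>"
    if "pointed_holder_selections TYPE('x) {a..b} g \<alpha> C" for C
    using pointed_holder_selections_imp_holder_selections[OF that] \<open>a < b\<close> by simp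
  ultimately show ?thesis by meson
qed

end
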